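(* Let $n,a,b,t$ be positive integers with $a\geq b+t-1$ and $n\geq a+b$. Suppose that $\mathcal{F}\subset\binom{[n]}{a}$ and $\mathcal{G}\subset\binom{[n]}{b}$ are initial cross-intersecting families with $\tau(\mathcal{F})\geq 1$ and $\tau(\mathcal{G})\geq t$. Then \[ |\mathcal{F}|+|\mathcal{G}|\leq |\mathcal{H}^t(n,a,b)|. \] Moreover, when $n>a+b$, equality holds if and only if $\mathcal{F}\cup\mathcal{G}$ is isomorphic to $\mathcal{H}^t(n,a,b)$.
   Context: $[n]=\{1,\dots,n\}$ and $\binom{[n]}{k}$ is the family of all $k$-element subsets of $[n]$. Two families $\mathcal{F},\mathcal{G}$ are cross-intersecting if $F\cap G\neq\emptyset$ for all $F\in\mathcal{F}$, $G\in\mathcal{G}$. For a family $\mathcal{F}$ of nonempty subsets of $[n]$, the covering number $\tau(\mathcal{F})$ is the minimum size of a set $T\subset[n]$ with $T\cap F\neq\emptyset$ for all $F\in\mathcal{F}$. For $1\le i<j\le n$ the shift $S_{ij}$ acts on a set $F$ by $S_{ij}(F)=(F\setminus\{j\})\cup\{i\}$ if $j\in F$, $i\notin F$ and $(F\setminus\{j\})\cup\{i\}\notin\mathcal{F}$, and $S_{ij}(F)=F$ otherwise; $S_{ij}(\mathcal{F})=\{S_{ij}(F):F\in\mathcal{F}\}$. A family $\mathcal{F}$ is initial if $S_{ij}(\mathcal{F})=\mathcal{F}$ for all $1\le i<j\le n$. Define $\mathcal{H}^t(n,a,b):=\{A\in\binom{[n]}{a}: |A\cap[b+t-1]|\geq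 t\}\cup\binom{[b+t-1]}{b}$. "$\mathcal{F}\cup\mathcal{G}$ is isomorphic to $\mathcal{H}$" means there is a permutation of $[n]$ mapping $\mathcal{F}\cup\mathcal{G}$ onto $\mathcal{H}$.
   Formalization: Two corrections: if a = b, the bound (also in the equality clause) is |H^t(n,a,b)| + 1, since the two parts of H share [b] and the literal bound fails; and "equality implies isomorphic" is not claimed when b = 2 and a = b+t−1, where other extremal pairs exist. *)

theory Defs
  imports "HOL-Library.Ramsey" "HOL-Combinatorics.Permutations"
begin

text \<open>The family of all \<open>k\<close>-element subsets of \<open>[n]\<close> is \<^term>\<open>nsets {1..n} k\<close>.\<close>

definition cross_intersecting :: "'a set set \<Rightarrow> 'a set set \<Rightarrow> bool" where
  "cross_intersecting \<F> \<G> \<longleftrightarrow> (\<forall>F\<in>\<F>. \<forall>G\<in>\<G>. F \<inter> G \<noteq> {})"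

text \<open>Meaningful for families of nonempty subsets of \<open>[n]\<close> only: then \<open>[n]\<close> itself is a
  cover, so the minimum is over a finite nonempty set. The empty family has covering number \<open>0\<close>.\<close>

definition covering_number :: "nat \<Rightarrow> nat set set \<Rightarrow> nat" where
  "covering_number n \<F> = Min (card ` {T. T \<subseteq> {1..n} \<and> (\<forall>F\<in>\<F>. T \<inter> F \<noteq> {})})"

definition shift_set :: "nat \<Rightarrow> nat \<Rightarrow> nat set set \<Rightarrow> nat set \<Rightarrow> nat set" where
  "shift_set i j \<F> F =
     (if j \<in> F \<and> i \<notin> F \<and> (F - {j}) \<union> {i} \<notin> \<F> then (F - {j}) \<union> {i} else F)"

definition shift_family :: "nat \<Rightarrow> nat \<Rightarrow> nat set set \<Rightarrow> nat set set" where
  "shift_family i j \<F> = shift_set i j \<F> ` \<F>"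

definition initial_family :: "nat \<Rightarrow> nat set set \<Rightarrow> bool" where
  "initial_family n \<F> \<longleftrightarrow>
     (\<forall>i j. 1 \<le> i \<and> i < j \<and> j \<le> n \<longrightarrow> shift_family i j \<F> = \<F>)"

definition H_family :: "nat \<Rightarrow> nat \<Rightarrow> nat \<Rightarrow> nat \<Rightarrow> nat set set" where
  "H_family t n a b =
     {A \<in> nsets {1..n} a. card (A \<inter> {1..b + t - 1}) \<ge> t} \<union> nsets {1..b + t - 1} b"

definition isomorphic_families :: "nat \<Rightarrow> nat set set \<Rightarrow> nat set set \<Rightarrow> bool" where
  "isomorphic_families n \<A> \<B> \<longleftrightarrow> (\<exists>p. p permutes {1..n} \<and> (\<lambda>A. p ` A) ` \<A> = \<B>)"

text \<open>The two parts of \<^const>\<open>H_family\<close> are disjoint unless \<open>a = b\<close>; then \<open>t = 1\<close> and they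
  share exactly the set \<open>[b]\<close>. Counting the parts separately, as the sum of the sizes of two
  families does, gives one more than the cardinality of the union in that case.\<close>

lemma card_H_family_parts:
  assumes "n \<ge> 1" "a \<ge> 1" "b \<ge> 1" "t \<ge> 1" "a \<ge> b + t - 1" "n \<ge> a + b"
  shows "card {A \<in> nsets {1..n} a. card (A \<inter> {1..b + t - 1}) \<ge> t} + card (nsets {1..b + t - 1} b)
       = card (H_family t n a b) + of_bool (a = b)"
proof -
  let ?X = "{A \<in> nsets {1..n} a. card (A \<inter> {1..b + t - 1}) \<ge> t}"
  let ?Y = "nsets {1..b + t - 1} b"
  have fin: "finite ?X" "finite ?Y"
    by (auto simp: finite_imp_finite_nsets)
  have "card (?X \<inter> ?Y) = of_bool (a = b)"
  proof (cases "a = b")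
    case False
    then have "?X \<inter> ?Y = {}" by (auto simp: nsets_def)
    with False show ?thesis by simp
  next
    case True
    with assms have t: "t = 1" by simp
    have "?X \<inter> ?Y = {{1..b}}"
    proof (intro equalityI subsetI)
      fix A assume "A \<in> ?X \<inter> ?Y"
      then have "A \<subseteq> {1..b}" "card A = b" by (auto simp: nsets_def t)
      then have "A = {1..b}" by (intro card_subset_eq) auto
      then show "A \<in> {{1..b}}" by simp
    next
      fix A assume "A \<in> {{1..b}}"
      then show "A \<in> ?X \<inter> ?Y" using assms True by (auto simp: nsets_def t)
    qed
    then show ?thesis using True by simp
  qed
  then show ?thesis
    unfolding H_family_def using card_Un_Int[OF fin] by simp
qed

end

theory Submission
  imports Defs
begin

text \<open>Put \<open>m = b + t - 1\<close>. Shifting turns the covering conditions into \<open>[a] \<in> \<F>\<close> and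
  \<open>nsets [m] b \<subseteq> \<G>\<close>, so every member of \<open>\<F>\<close> is heavy: it meets \<open>[m]\<close> in at least \<open>t\<close> points.
  Induct on \<open>n\<close> by splitting both families according to whether they contain the last point. For
  \<open>n = a + b\<close> the bound is complementation. For larger \<open>n\<close> the members avoiding \<open>n\<close> are covered by
  induction, and the links of \<open>n\<close> are again cross-intersecting. For the links it suffices that
  together they have at most as many members as there are heavy \<open>(a - 1)\<close>-sets. This holds with
  \<open>b - 1\<close> in place of \<open>b\<close>, by a second induction of the same kind, because \<open>(b - 1) + t \<le> m\<close>; in
  the extreme case \<open>a = m\<close> it also uses that the link of \<open>\<G>\<close> meets \<open>[m] = [a] \<in> \<F>\<close>. If the bound
  is attained, the link of \<open>\<G>\<close> is empty, hence that of \<open>\<F>\<close> is the full heavy family and shifting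
  forces \<open>\<F>\<close> and \<open>\<G>\<close>; otherwise \<open>a = b\<close> and the roles of the two families are swapped.\<close>

section \<open>Shift-closed families, deletions and links\<close>

text \<open>Being initial is kept only in this pointwise form, which passes at once to the members
  avoiding the last point and to the link of that point.\<close>

definition shift_closed :: "nat \<Rightarrow> nat set set \<Rightarrow> bool" where
  "shift_closed n \<F> \<longleftrightarrow>
     (\<forall>A\<in>\<F>. \<forall>i j. 1 \<le> i \<longrightarrow> i < j \<longrightarrow> j \<le> n \<longrightarrow> j \<in> A \<longrightarrow> i \<notin> A \<longrightarrow> insert i (A - {j}) \<in> \<F>)"

definition deletion :: "nat \<Rightarrow> nat set set \<Rightarrow> nat set set" where
  "deletion n \<F> = {A \<in> \<F>. n \<notin> A}"

definition link :: "nat \<Rightarrow> nat set set \<Rightarrow> nat set set" where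
  "link n \<F> = {A. n \<notin> A \<and> insert n A \<in> \<F>}"

definition heavy :: "nat \<Rightarrow> nat \<Rightarrow> nat \<Rightarrow> nat \<Rightarrow> nat set set" where
  "heavy n a m t = {A \<in> nsets {1..n} a. t \<le> card (A \<inter> {1..m})}"

lemma initial_family_imp_shift_closed:
  assumes "initial_family n \<F>"
  shows "shift_closed n \<F>"
  unfolding shift_closed_def
proof (intro ballI allI impI)
  fix A i j assume A: "A \<in> \<F>" and ij: "1 \<le> i" "i < j" "j \<le> n" "j \<in> A" "i \<notin> A"
  then have "shift_family i j \<F> = \<F>" using assms by (auto simp: initial_family_def)
  then have "shift_set i j \<F> A \<in> \<F>" using A by (auto simp: shift_family_def)
  then show "insert i (A - {j}) \<in> \<F>" using ij by (auto simp: shift_set_def split: if_splits)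
qed

lemma shift_closedD:
  assumes "shift_closed n \<F>" "A \<in> \<F>" "1 \<le> i" "i < j" "j \<le> n" "j \<in> A" "i \<notin> A"
  shows "insert i (A - {j}) \<in> \<F>"
  using assms unfolding shift_closed_def by blast

lemma finite_subset_nsets: "\<F> \<subseteq> nsets {1..n::nat} k \<Longrightarrow> finite \<F>"
  by (rule finite_subset) (auto simp: finite_imp_finite_nsets)

lemma heavy_subset_nsets: "heavy n a m t \<subseteq> nsets {1..n} a"
  by (auto simp: heavy_def)

lemma finite_heavy [simp]: "finite (heavy n a m t)"
  using finite_subset_nsets heavy_subset_nsets by blast

lemma card_deletion_link:
  assumes "finite \<F>"
  shows "card \<F> = card (deletion n \<F>) + card (link n \<F>)"
proof -
  have "insert n ` link n \<F> = {A \<in> \<F>. n \<in> A}"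
  proof
    show "{A \<in> \<F>. n \<in> A} \<subseteq> insert n ` link n \<F>"
    proof
      fix A assume "A \<in> {A \<in> \<F>. n \<in> A}"
      then have "A = insert n (A - {n})" "A - {n} \<in> link n \<F>"
        by (auto simp: link_def insert_absorb)
      then show "A \<in> insert n ` link n \<F>" by blast
    qed
  qed (auto simp: link_def)
  moreover have "inj_on (insert n) (link n \<F>)"
    unfolding inj_on_def link_def by (auto dest: insert_ident[THEN iffD1, rotated 2])
  ultimately have l: "card (link n \<F>) = card {A \<in> \<F>. n \<in> A}"
    by (metis card_image)
  have "\<F> = deletion n \<F> \<union> {A \<in> \<F>. n \<in> A}" by (auto simp: deletion_def)
  then have "card \<F> = card (deletion n \<F>) + card {A \<in> \<F>. n \<in> A}"
    using assms by (metis (no_types, lifting) card_Un_disjoint deletion_def disjoint_iff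
        finite_Un mem_Collect_eq)
  then show ?thesis using l by simp
qed

lemma deletion_subset_nsets:
  assumes "\<F> \<subseteq> nsets {1..Suc n} k"
  shows "deletion (Suc n) \<F> \<subseteq> nsets {1..n} k"
  using assms by (fastforce simp: deletion_def nsets_def le_Suc_eq subset_iff)

lemma link_subset_nsets:
  assumes "\<F> \<subseteq> nsets {1..Suc n} (Suc k)"
  shows "link (Suc n) \<F> \<subseteq> nsets {1..n} k"
proof
  fix A assume "A \<in> link (Suc n) \<F>"
  then have A: "Suc n \<notin> A" "insert (Suc n) A \<in> nsets {1..Suc n} (Suc k)"
    using assms by (auto simp: link_def)
  then have "finite A" "card A = k" by (auto simp: nsets_def)
  moreover have "A \<subseteq> {1..n}"
  proof
    fix x assume "x \<in> A"
    then have "x \<in> {1..Suc n}" "x \<noteq> Suc n" using A by (auto simp: nsets_def)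
    then show "x \<in> {1..n}" by simp
  qed
  ultimately show "A \<in> nsets {1..n} k" by (simp add: nsets_def)
qed

lemma deletion_heavy: "deletion (Suc n) (heavy (Suc n) a m t) = heavy n a m t"
proof
  show "deletion (Suc n) (heavy (Suc n) a m t) \<subseteq> heavy n a m t"
    using deletion_subset_nsets[OF heavy_subset_nsets, of n a m t] by (auto simp: deletion_def heavy_def)
  show "heavy n a m t \<subseteq> deletion (Suc n) (heavy (Suc n) a m t)"
    by (fastforce simp: deletion_def heavy_def nsets_def)
qed

text \<open>Since \<open>m <= n\<close>, the removed point lies outside \<open>[m]\<close>, so the
  threshold \<open>t\<close> stays. With \<open>deletion_heavy\<close> this gives a Pascal recursion
  that the inductive bounds match term by term.\<close>

lemma link_heavy:
  assumes "m \<le> n"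
  shows "link (Suc n) (heavy (Suc n) (Suc a) m t) = heavy n a m t"
proof
  have [simp]: "insert (Suc n) A \<inter> {Suc 0..m} = A \<inter> {Suc 0..m}" for A using assms by auto
  show "link (Suc n) (heavy (Suc n) (Suc a) m t) \<subseteq> heavy n a m t"
    using link_subset_nsets[OF heavy_subset_nsets, of n a m t] by (auto simp: link_def heavy_def)
  show "heavy n a m t \<subseteq> link (Suc n) (heavy (Suc n) (Suc a) m t)"
  proof
    fix A assume A: "A \<in> heavy n a m t"
    then have "A \<subseteq> {1..n}" by (auto simp: heavy_def nsets_def)
    then have "Suc n \<notin> A" by auto
    then show "A \<in> link (Suc n) (heavy (Suc n) (Suc a) m t)"
      using A by (auto simp: link_def heavy_def nsets_def)
  qed
qed

lemma card_heavy_Suc: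
  assumes "m \<le> n"
  shows "card (heavy (Suc n) (Suc a) m t) = card (heavy n (Suc a) m t) + card (heavy n a m t)"
  using card_deletion_link[of "heavy (Suc n) (Suc a) m t" "Suc n"] assms
  by (simp add: deletion_heavy link_heavy)

lemma deletion_mono: "\<F> \<subseteq> \<G> \<Longrightarrow> deletion n \<F> \<subseteq> deletion n \<G>"
  by (auto simp: deletion_def)

lemma link_mono: "\<F> \<subseteq> \<G> \<Longrightarrow> link n \<F> \<subseteq> link n \<G>"
  by (auto simp: link_def)

lemma shift_closed_deletion:
  assumes "shift_closed (Suc n) \<F>"
  shows "shift_closed n (deletion (Suc n) \<F>)"
  using assms by (auto simp: shift_closed_def deletion_def)

lemma shift_closed_link:
  assumes "shift_closed (Suc n) \<F>"
  shows "shift_closed n (link (Suc n) \<F>)"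
  unfolding shift_closed_def
proof (intro ballI allI impI)
  fix A i j assume A: "A \<in> link (Suc n) \<F>" and ij: "1 \<le> i" "i < j" "j \<le> n" "j \<in> A" "i \<notin> A"
  have "insert i (insert (Suc n) A - {j}) \<in> \<F>"
    using assms A ij by (auto simp: shift_closed_def link_def)
  moreover have "insert i (insert (Suc n) A - {j}) = insert (Suc n) (insert i (A - {j}))"
    using ij by auto
  ultimately show "insert i (A - {j}) \<in> link (Suc n) \<F>"
    using A ij by (auto simp: link_def)
qed

lemma cross_intersecting_deletion:
  "cross_intersecting \<F> \<G> \<Longrightarrow> cross_intersecting (deletion n \<F>) (deletion n \<G>)"
  by (auto simp: cross_intersecting_def deletion_def)

text \<open>If two members met only in the last point, that point could be shifted in one of them to a
  point covered by neither.\<close>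

lemma cross_intersecting_link:
  assumes cross: "cross_intersecting \<F> \<G>" and st: "shift_closed (Suc n) \<F>"
    and F: "\<F> \<subseteq> nsets {1..Suc n} (Suc a)" and G: "\<G> \<subseteq> nsets {1..Suc n} (Suc b)"
    and n: "a + b < n"
  shows "cross_intersecting (link (Suc n) \<F>) (link (Suc n) \<G>)"
  unfolding cross_intersecting_def
proof (intro ballI notI)
  fix A B assume A: "A \<in> link (Suc n) \<F>" and B: "B \<in> link (Suc n) \<G>" and AB: "A \<inter> B = {}"
  have "A \<in> nsets {1..n} a" "B \<in> nsets {1..n} b"
    using A B link_subset_nsets[OF F] link_subset_nsets[OF G] by auto
  then have "card (A \<union> B) < card {1..n}" "finite (A \<union> B)"
    using n card_Un_le[of A B] by (auto simp: nsets_def)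
  then obtain x where x: "x \<in> {1..n}" "x \<notin> A \<union> B"
    by (meson card_mono not_less subsetI)
  have "insert x (insert (Suc n) A - {Suc n}) \<in> \<F>"
    using A x by (intro shift_closedD[OF st]) (auto simp: link_def)
  then have "insert x A \<in> \<F>" using A by (simp add: link_def)
  then have "insert x A \<inter> insert (Suc n) B \<noteq> {}"
    using cross B unfolding cross_intersecting_def link_def by blast
  then show False using A B AB x by (auto simp: link_def)
qed

section \<open>Upper bounds by complementation and Pascal-type induction\<close>

text \<open>A member of \<open>\<F>\<close> cannot be the complement of a member of
  \<open>\<G>\<close>, as the two would be disjoint. So \<open>\<F>\<close> and the complements of
  \<open>\<G>\<close> are disjoint parts of \<open>\<R>\<close>.\<close>

lemma card_add_le_of_complement:
  assumes "cross_intersecting \<F> \<G>" "\<F> \<subseteq> \<R>" "finite \<R>" "\<G> \<subseteq> Pow X" "\<And>B. B \<in> \<G> \<Longrightarrow> X - B \<in> \<R>"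
  shows "card \<F> + card \<G> \<le> card \<R>"
proof -
  have "inj_on ((-) X) \<G>"
    using assms(4) by (auto simp: inj_on_def)
  then have "card \<G> = card ((-) X ` \<G>)" by (simp add: card_image)
  moreover have "\<F> \<inter> (-) X ` \<G> = {}"
    using assms(1) by (auto simp: cross_intersecting_def)
  moreover have "\<F> \<union> (-) X ` \<G> \<subseteq> \<R>" using assms by auto
  ultimately show ?thesis
    using assms(3) by (metis card_Un_disjoint card_mono finite_Un finite_subset)
qed

lemma compl_mem_nsets:
  assumes "B \<in> nsets {1..a + b} b"
  shows "{1..a + b} - B \<in> nsets {1..a + b} a"
  using assms by (auto simp: nsets_def card_Diff_subset)

lemma nsets_zero_cases:
  assumes "\<G> \<subseteq> nsets X 0"
  shows "\<G> = {} \<or> \<G> = {{}}"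
  using assms by (auto simp: nsets_def)

text \<open>Serves the situation \<open>m = n\<close> below, where every \<open>a\<close>-set is
  heavy. By Pascal's rule it suffices to bound deletions and links separately.\<close>

lemma cross_intersecting_card_le_choose:
  assumes "\<F> \<subseteq> nsets {1..n} a" "\<G> \<subseteq> nsets {1..n} b" "shift_closed n \<F>" "shift_closed n \<G>"
    "cross_intersecting \<F> \<G>" "b \<le> a" "a + b \<le> n"
  shows "card \<F> + card \<G> \<le> n choose a"
  using assms
proof (induction n arbitrary: a b \<F> \<G>)
  case 0
  then have "\<F> = {} \<or> \<F> = {{}}" "\<G> = {} \<or> \<G> = {{}}" using nsets_zero_cases by auto
  then show ?case using 0 by (auto simp: cross_intersecting_def)
next
  case (Suc n)
  note fin = finite_subset_nsets[OF Suc.prems(1)] finite_subset_nsets[OF Suc.prems(2)]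
  have Fle: "card \<F> \<le> Suc n choose a"
    using card_mono[OF _ Suc.prems(1)] by (simp add: finite_imp_finite_nsets)
  \<comment> \<open>Links lower \<open>a\<close> and \<open>b\<close> together, and
    \<open>b <= a\<close> makes \<open>b\<close> reach 0 first. At \<open>a + b = Suc n\<close> the
    deletions would violate \<open>a + b <= n\<close>, so complementation takes over.\<close>
  consider "b = 0" | "a + b = Suc n" | a' b' where "a = Suc a'" "b = Suc b'" "a + b \<le> n"
    using Suc.prems(6,7) by (cases a; cases b) force+
  then show ?case
  proof cases
    case 1
    then consider "\<G> = {}" | "\<G> = {{}}" using nsets_zero_cases Suc.prems(2) by blast
    then show ?thesis
    proof cases
      case 2
      then have "\<F> = {}" using Suc.prems(5) by (auto simp: cross_intersecting_def)
      then show ?thesis using 2 Suc.prems(7) by (simp add: Suc_le_eq)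
    qed (use Fle in simp)
  next
    case 2
    have "card \<F> + card \<G> \<le> card (nsets {1..Suc n} a)"
    proof (rule card_add_le_of_complement[of _ _ _ "{1..Suc n}"])
      show "{1..Suc n} - B \<in> nsets {1..Suc n} a" if "B \<in> \<G>" for B
        using compl_mem_nsets[of B a b] 2 that Suc.prems(2) by auto
      show "\<G> \<subseteq> Pow {1..Suc n}" using Suc.prems(2) by (auto simp: nsets_def)
    qed (use Suc.prems in \<open>auto simp: finite_imp_finite_nsets\<close>)
    then show ?thesis by simp
  next
    case 3
    note p = Suc.prems[unfolded 3]
    have "card (deletion (Suc n) \<F>) + card (deletion (Suc n) \<G>) \<le> n choose Suc a'"
      using p 3 by (intro Suc.IH[of _ "Suc a'" _ "Suc b'"] deletion_subset_nsets shift_closed_deletion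
          cross_intersecting_deletion) auto
    moreover have "card (link (Suc n) \<F>) + card (link (Suc n) \<G>) \<le> n choose a'"
      using p 3 by (intro Suc.IH[of _ "a'" _ "b'"] link_subset_nsets shift_closed_link
          cross_intersecting_link[of _ _ _ a' b']) auto
    ultimately show ?thesis
      using card_deletion_link[OF fin(1), of "Suc n"] card_deletion_link[OF fin(2), of "Suc n"] 3
      by simp
  qed
qed

text \<open>Take \<open>t\<close> points of \<open>[m]\<close> outside \<open>B\<close> and fill up
  with further points outside \<open>B\<close>. This yields the contradiction whenever one family
  contains all heavy sets.\<close>

lemma heavy_disjoint_exists:
  assumes "B \<subseteq> {1..n}" "card B + a \<le> n" "t \<le> card ({1..m} - B)" "m \<le> n" "t \<le> a"
  shows "\<exists>A\<in>heavy n a m t. A \<inter> B = {}"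
proof -
  obtain T where T: "T \<subseteq> {1..m} - B" "card T = t"
    using assms(3) by (meson obtain_subset_with_card_n)
  have "finite B" using assms(1) finite_subset by blast
  then have "a \<le> card ({1..n} - B)" using assms by (simp add: card_Diff_subset)
  then obtain A where A: "T \<subseteq> A" "A \<subseteq> {1..n} - B" "card A = a"
    using exists_subset_between[of T a "{1..n} - B"] T assms by force
  have "finite A" using A(2) finite_subset by blast
  then have "t \<le> card (A \<inter> {1..m})"
    using T A(1) card_mono[of "A \<inter> {1..m}" T] by auto
  then have "A \<in> heavy n a m t" "A \<inter> B = {}"
    using A \<open>finite A\<close> by (auto simp: heavy_def nsets_def)
  then show ?thesis by blast
qed

lemma card_interval_Diff_ge:
  assumes "card B + t \<le> m" "finite B"
  shows "t \<le> card ({1..m} - B)"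
  using assms diff_card_le_card_Diff[of B "{1..m}"] by simp

text \<open>The induction can end with \<open>b = 0\<close> and \<open>\<G> = {{}}\<close>; then a
  heavy set must exist to pay for this one member, which needs \<open>t <= a\<close>. The last
  assumption secures that, its second alternative by ruling out the empty set. Both alternatives
  pass to deletions and links, the second because the removed point is outside
  \<open>[m]\<close>.\<close>

lemma cross_intersecting_card_le_heavy:
  assumes "1 \<le> t" "m \<le> n" "b + t \<le> m" "b + t \<le> Suc a" "a + b \<le> n"
    "\<F> \<subseteq> heavy n a m t" "\<G> \<subseteq> nsets {1..n} b" "shift_closed n \<F>" "shift_closed n \<G>"
    "cross_intersecting \<F> \<G>" "b + t \<le> a \<or> (\<forall>B\<in>\<G>. B \<inter> {1..m} \<noteq> {})"
  shows "card \<F> + card \<G> \<le> card (heavy n a m t)"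
  using assms
proof (induction n arbitrary: a b \<F> \<G>)
  case 0
  then show ?case by simp
next
  case (Suc n)
  have Fn: "\<F> \<subseteq> nsets {1..Suc n} a" using Suc.prems(6) heavy_subset_nsets by blast
  note fin = finite_subset_nsets[OF Fn] finite_subset_nsets[OF Suc.prems(7)]
  have Fle: "card \<F> \<le> card (heavy (Suc n) a m t)"
    using card_mono[OF _ Suc.prems(6)] by simp
  consider "b = 0" | "a + b = Suc n" | "m = Suc n" "b \<noteq> 0"
    | a' b' where "a = Suc a'" "b = Suc b'" "a + b \<le> n" "m \<le> n"
    using Suc.prems(1-5) by (cases a; cases b) force+
  then show ?case
  proof cases
    case 1
    then consider "\<G> = {}" | "\<G> = {{}}" using nsets_zero_cases Suc.prems(7) by blast
    then show ?thesis
    proof cases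
      case 2
      then have "t \<le> a" using Suc.prems(11) by auto
      then obtain A where "A \<in> heavy (Suc n) a m t"
        using heavy_disjoint_exists[of "{}" "Suc n" a t m] Suc.prems(2,3,5) by auto
      then have "card (heavy (Suc n) a m t) > 0" by (auto simp: card_gt_0_iff)
      moreover have "\<F> = {}" using 2 Suc.prems(10) by (auto simp: cross_intersecting_def)
      ultimately show ?thesis using 2 by simp
    qed (use Fle in simp)
  next
    case 2
    show ?thesis
    proof (rule card_add_le_of_complement[of _ _ _ "{1..Suc n}"])
      \<comment> \<open>The complement of a \<open>b\<close>-set keeps at least
        \<open>m - b >= t\<close> points of \<open>[m]\<close>.\<close>
      show "{1..Suc n} - B \<in> heavy (Suc n) a m t" if "B \<in> \<G>" for B
      proof -
        have B: "card B = b" "finite B" using that Suc.prems(7) by (auto simp: nsets_def)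
        have "({1..Suc n} - B) \<inter> {1..m} = {1..m} - B" using Suc.prems(2) by auto
        then have "t \<le> card (({1..Suc n} - B) \<inter> {1..m})"
          using card_interval_Diff_ge[of B t m] B Suc.prems(3) by simp
        then show ?thesis
          using compl_mem_nsets[of B a b] 2 that Suc.prems(7) by (auto simp: heavy_def)
      qed
      show "\<G> \<subseteq> Pow {1..Suc n}" using Suc.prems(7) by (auto simp: nsets_def)
    qed (use Suc.prems in auto)
  next
    \<comment> \<open>The last point lies in \<open>[m]\<close>, so the recursion for heavy sets
      breaks off. But now \<open>[m]\<close> is the whole ground set and \<open>t <= a\<close>, so
      all \<open>a\<close>-sets are heavy.\<close>
    case 3
    have "heavy (Suc n) a m t = nsets {1..Suc n} a"
    proof -
      have "t \<le> card (A \<inter> {1..m})" if "A \<in> nsets {1..Suc n} a" for A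
      proof -
        have "A \<inter> {1..m} = A" "card A = a" using that 3 by (auto simp: nsets_def)
        then show ?thesis using Suc.prems(4) 3 by simp
      qed
      then show ?thesis by (auto simp: heavy_def)
    qed
    moreover have "card \<F> + card \<G> \<le> Suc n choose a"
      using Suc.prems 3 by (intro cross_intersecting_card_le_choose[OF Fn Suc.prems(7)]) auto
    ultimately show ?thesis by simp
  next
    case 4
    note p = Suc.prems[unfolded 4] Fn[unfolded 4]
    have "card (deletion (Suc n) \<F>) + card (deletion (Suc n) \<G>) \<le> card (heavy n (Suc a') m t)"
    proof (rule Suc.IH[of "Suc b'" "Suc a'"])
      show "deletion (Suc n) \<F> \<subseteq> heavy n (Suc a') m t"
        using deletion_mono[OF p(6), of "Suc n"] by (simp add: deletion_heavy)
      show "Suc b' + t \<le> Suc a' \<or> (\<forall>B\<in>deletion (Suc n) \<G>. B \<inter> {1..m} \<noteq> {})"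
        using p(11) by (auto simp: deletion_def)
    qed (use p(1-5) 4 deletion_subset_nsets[OF p(7)] shift_closed_deletion[OF p(8)]
        shift_closed_deletion[OF p(9)] cross_intersecting_deletion[OF p(10)] in simp_all)
    moreover have "card (link (Suc n) \<F>) + card (link (Suc n) \<G>) \<le> card (heavy n a' m t)"
    proof (rule Suc.IH[of "b'" "a'"])
      show "link (Suc n) \<F> \<subseteq> heavy n a' m t"
        using link_mono[OF p(6), of "Suc n"] 4 by (simp add: link_heavy)
      show "b' + t \<le> a' \<or> (\<forall>B\<in>link (Suc n) \<G>. B \<inter> {1..m} \<noteq> {})"
        using p(11) 4(4) by (fastforce simp: link_def)
      show "cross_intersecting (link (Suc n) \<F>) (link (Suc n) \<G>)"
        using 4 by (intro cross_intersecting_link[OF p(10,8,12,7)]) simp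
    qed (use p(1-5) 4 link_subset_nsets[OF p(7)] shift_closed_link[OF p(8)]
        shift_closed_link[OF p(9)] in simp_all)
    ultimately show ?thesis
      using card_deletion_link[OF fin(1), of "Suc n"] card_deletion_link[OF fin(2), of "Suc n"] 4
        card_heavy_Suc[of m n a' t]
      by simp
  qed
qed

section \<open>Strict inequality for a nonempty second family\<close>

text \<open>For a heavy \<open>A\<close> avoiding the last point, trade some \<open>x\<close> in
  \<open>A\<close> for the last point without losing heaviness. The result lies in
  \<open>\<F>\<close> through the link, and shifting the last point to \<open>x\<close> gives back
  \<open>A\<close>. Any \<open>x\<close> outside \<open>[m]\<close> will do; if \<open>A\<close>
  lies in \<open>[m]\<close>, any \<open>x\<close> at all, because \<open>a >= t\<close> points
  remain.\<close>

lemma heavy_subset_of_link: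
  assumes st: "shift_closed (Suc n) \<F>" and l: "heavy n a m t \<subseteq> link (Suc n) \<F>" and "m \<le> n" "t \<le> a"
  shows "heavy (Suc n) (Suc a) m t \<subseteq> \<F>"
proof
  fix A assume A: "A \<in> heavy (Suc n) (Suc a) m t"
  then have An: "A \<subseteq> {1..Suc n}" "finite A" "card A = Suc a" "t \<le> card (A \<inter> {1..m})"
    by (auto simp: heavy_def nsets_def)
  show "A \<in> \<F>"
  proof (cases "Suc n \<in> A")
    case True
    then have "A - {Suc n} \<in> link (Suc n) (heavy (Suc n) (Suc a) m t)"
      using A by (simp add: link_def insert_absorb)
    then have "A - {Suc n} \<in> link (Suc n) \<F>" using l \<open>m \<le> n\<close> link_heavy by blast
    then show ?thesis using True by (simp add: link_def insert_absorb)
  next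
    case False
    have "\<exists>x\<in>A. t \<le> card ((A - {x}) \<inter> {1..m})"
    proof (cases "A \<subseteq> {1..m}")
      case True
      obtain x where x: "x \<in> A" using An by fastforce
      have "(A - {x}) \<inter> {1..m} = A - {x}" using True by auto
      then have "t \<le> card ((A - {x}) \<inter> {1..m})"
        using x An \<open>t \<le> a\<close> by (simp only: card_Diff_singleton)
      then show ?thesis using x by blast
    next
      case False
      then obtain x where x: "x \<in> A" "x \<notin> {1..m}" by blast
      then have "(A - {x}) \<inter> {1..m} = A \<inter> {1..m}" by auto
      then show ?thesis using x An by metis
    qed
    then obtain x where x: "x \<in> A" "t \<le> card ((A - {x}) \<inter> {1..m})" by blast
    have xn: "1 \<le> x" "x < Suc n" using x An False
      by (auto simp: subset_iff le_less less_Suc_eq)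
    have "A - {x} \<subseteq> {1..n}"
    proof
      fix y assume "y \<in> A - {x}"
      then have "y \<in> {1..Suc n}" "y \<noteq> Suc n" using An False by auto
      then show "y \<in> {1..n}" by simp
    qed
    then have "A - {x} \<in> heavy n a m t" using An x by (auto simp: heavy_def nsets_def)
    then have *: "insert (Suc n) (A - {x}) \<in> \<F>" using l by (auto simp: link_def)
    have "insert x (insert (Suc n) (A - {x}) - {Suc n}) \<in> \<F>"
      using xn False by (intro shift_closedD[OF st *]) auto
    moreover have "insert x (insert (Suc n) (A - {x}) - {Suc n}) = A" using x False by auto
    ultimately show ?thesis by simp
  qed
qed


lemma le_choose:
  assumes "1 \<le> k" "k < n"
  shows "n \<le> n choose k"
  using assms
proof (induction n arbitrary: k)
  case (Suc n)
  then obtain j where k: "k = Suc j" by (cases k) auto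
  show ?case
  proof (cases "k = n")
    case False
    then have "n \<le> n choose k" using Suc by simp
    moreover have "0 < n choose j" using Suc.prems k by simp
    ultimately show ?thesis unfolding k binomial_Suc_Suc by linarith
  qed auto
qed simp

text \<open>The heavy sets are here the \<open>t\<close>-subsets of \<open>[m]\<close>. If
  \<open>\<F>\<close> is nonempty, one member contains all singletons of \<open>\<G>\<close>, so
  these number at most \<open>t\<close>, while one \<open>{x}\<close> in \<open>\<G>\<close> keeps
  at least \<open>m - 1 > t\<close> heavy sets out of \<open>\<F>\<close>. If \<open>\<F>\<close> is
  empty, \<open>\<G>\<close> has at most \<open>m\<close> members, fewer than
  \<open>m choose t\<close> when \<open>2 <= t\<close>. For \<open>t = 1\<close> and empty
  \<open>\<F>\<close>, all singletons of \<open>[m]\<close> would give equality.\<close>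

lemma cross_intersecting_singletons_strict:
  assumes "1 \<le> t" "t + 2 \<le> m" "m \<le> n"
    and F: "\<F> \<subseteq> heavy n t m t" and G: "\<G> \<subseteq> nsets {1..n} 1" and cross: "cross_intersecting \<F> \<G>"
    and "\<G> \<noteq> {}" and meets: "\<forall>B\<in>\<G>. B \<inter> {1..m} \<noteq> {}" and "2 \<le> t \<or> \<F> \<noteq> {}"
  shows "card \<F> + card \<G> < card (heavy n t m t)"
proof -
  have "heavy n t m t = nsets {1..m} t"
  proof
    show "heavy n t m t \<subseteq> nsets {1..m} t"
    proof
      fix A assume "A \<in> heavy n t m t"
      then have A: "finite A" "card A = t" "t \<le> card (A \<inter> {1..m})"
        by (auto simp: heavy_def nsets_def)
      then have "A \<inter> {1..m} = A" by (intro card_seteq) auto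
      then show "A \<in> nsets {1..m} t" using A by (auto simp: nsets_def)
    qed
    show "nsets {1..m} t \<subseteq> heavy n t m t"
    proof
      fix A assume "A \<in> nsets {1..m} t"
      then have A: "finite A" "card A = t" "A \<subseteq> {1..m}" by (auto simp: nsets_def)
      then have "A \<inter> {1..m} = A" by blast
      then show "A \<in> heavy n t m t" using A \<open>m \<le> n\<close> by (fastforce simp: heavy_def nsets_def)
    qed
  qed
  note heavy_eq = this
  have singleton: "\<exists>x. B = {x} \<and> x \<in> {1..m}" if "B \<in> \<G>" for B
  proof -
    have "card B = 1" using that G by (auto simp: nsets_def)
    then obtain x where "B = {x}" using card_1_singletonE by blast
    then show ?thesis using meets that by auto
  qed
  obtain r where m: "m = Suc r" using assms by (cases m) auto
  obtain s where t: "t = Suc s" using assms by (cases t) auto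
  \<comment> \<open>When \<open>\<F>\<close> is empty, both summands are at least
    \<open>r = m - 1\<close>, and \<open>2 * r > m\<close>.\<close>
  have pascal: "m choose t = (r choose s) + (r choose t)" by (simp add: m t)
  show ?thesis
  proof (cases "\<F> = {}")
    case True
    then have "2 \<le> t" using assms by auto
    have "\<G> \<subseteq> nsets {1..m} 1" using singleton by (fastforce simp: nsets_def)
    then have "card \<G> \<le> m choose 1"
      using card_mono[of "nsets {1..m} 1" \<G>] by (simp add: finite_imp_finite_nsets)
    moreover have "r \<le> r choose s" "r \<le> r choose t"
      using \<open>2 \<le> t\<close> assms(2) m t by (auto intro!: le_choose)
    moreover have "card (heavy n t m t) = (r choose s) + (r choose t)"
      using heavy_eq pascal by simp
    ultimately show ?thesis using True \<open>2 \<le> t\<close> assms(2) m by (simp del: binomial_Suc_Suc)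
  next
    case False
    then obtain A where A: "A \<in> \<F>" by blast
    then have An: "finite A" "card A = t" using F by (auto simp: heavy_def nsets_def)
    have "\<G> \<subseteq> nsets A 1"
    proof
      fix B assume B: "B \<in> \<G>"
      then obtain x where "B = {x}" using singleton by blast
      then show "B \<in> nsets A 1" using cross A B by (auto simp: cross_intersecting_def nsets_def)
    qed
    then have G_le: "card \<G> \<le> t"
      using card_mono[of "nsets A 1" \<G>] An by (simp add: finite_imp_finite_nsets)
    obtain x where x: "{x} \<in> \<G>" "x \<in> {1..m}" using singleton \<open>\<G> \<noteq> {}\<close> by blast
    have "\<F> \<inter> nsets ({1..m} - {x}) t = {}"
      using cross x(1) by (auto simp: cross_intersecting_def nsets_def)
    moreover have "\<F> \<union> nsets ({1..m} - {x}) t \<subseteq> nsets {1..m} t"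
      using F heavy_eq by (auto simp: nsets_def)
    moreover have "finite (nsets {1..m} t)" by (simp add: finite_imp_finite_nsets)
    ultimately have "card \<F> + card (nsets ({1..m} - {x}) t) \<le> card (nsets {1..m} t)"
      by (metis card_Un_disjoint card_mono finite_Un finite_subset)
    moreover have "card (nsets ({1..m} - {x}) t) = r choose t" using x m by simp
    moreover have "r \<le> r choose t" using assms m by (intro le_choose) auto
    moreover have "card (heavy n t m t) = card (nsets {1..m} t)" by (simp only: heavy_eq)
    ultimately show ?thesis using G_le assms(2) m by linarith
  qed
qed

text \<open>Against \<open>\<G> = {{}}\<close> a strict bound needs two heavy sets:
  \<open>[a]\<close> and its translate by one, which is heavy because \<open>t < m\<close>.\<close>

lemma two_le_card_heavy:
  assumes "1 \<le> t" "t \<le> a" "t < m" "a < n"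
  shows "2 \<le> card (heavy n a m t)"
proof -
  have "{1..a} \<inter> {1..m} = {1..min a m}" "{2..Suc a} \<inter> {1..m} = {2..min (Suc a) m}" by auto
  then have "{1..a} \<in> heavy n a m t" "{2..Suc a} \<in> heavy n a m t"
    using assms by (auto simp: heavy_def nsets_def)
  then have "card {{1..a}, {2..Suc a}} \<le> card (heavy n a m t)"
    by (intro card_mono) auto
  moreover have "1 \<in> {1..a}" "1 \<notin> {2..Suc a}" using assms by auto
  then have "{1..a} \<noteq> {2..Suc a}" by metis
  ultimately show ?thesis by simp
qed

text \<open>Induction on \<open>b\<close>: strictness comes from the links, while the weak bound
  suffices for deletions. If the link of \<open>\<G>\<close> is empty, attaining the bound would put
  all heavy sets into \<open>\<F>\<close>, and one of them misses a member of \<open>\<G>\<close>.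
  The second alternative of the last assumption is the borderline
  \<open>Suc a = b + t\<close>.\<close>

lemma cross_intersecting_card_less_heavy:
  assumes "1 \<le> t" "t < m" "b + t \<le> m" "m + b < n" "a + b < n"
    "\<F> \<subseteq> heavy n a m t" "\<G> \<subseteq> nsets {1..n} b" "shift_closed n \<F>" "shift_closed n \<G>"
    "cross_intersecting \<F> \<G>" "\<G> \<noteq> {}"
    "b + t \<le> a \<or>
     Suc a = b + t \<and> t + 2 \<le> m \<and> (2 \<le> t \<or> \<F> \<noteq> {}) \<and> (\<forall>B\<in>\<G>. B \<inter> {1..m} \<noteq> {})"
  shows "card \<F> + card \<G> < card (heavy n a m t)"
  using assms
proof (induction b arbitrary: a n \<F> \<G>)
  case 0
  then have "\<G> = {{}}" using nsets_zero_cases by blast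
  moreover then have "\<F> = {}" "t \<le> a"
    using 0 by (auto simp: cross_intersecting_def)
  ultimately show ?case using two_le_card_heavy[of t a m n] 0 by simp
next
  case (Suc b)
  obtain n' where n: "n = Suc n'" using Suc.prems(5) by (cases n) auto
  obtain a' where a: "a = Suc a'" using Suc.prems(1,12) by (cases a) auto
  note p = Suc.prems[unfolded n a]
  have Fn: "\<F> \<subseteq> nsets {1..Suc n'} (Suc a')" using p(6) heavy_subset_nsets by blast
  note fin = finite_subset_nsets[OF Fn] finite_subset_nsets[OF p(7)]
  have mn: "m \<le> n'" using p(4) by simp
  show ?case
  proof (cases "a = t")
    \<comment> \<open>Only the borderline alternative is possible, and it forces the members of
      \<open>\<G>\<close> to be singletons.\<close>
    case True
    then have "b = 0" using p(12) a by auto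
    then show ?thesis
      using cross_intersecting_singletons_strict[of t m n \<F> \<G>] Suc.prems True by auto
  next
    case False
    then have ta: "t \<le> a'" using p(12) a by auto
    show ?thesis
    proof (rule ccontr)
      assume "\<not> card \<F> + card \<G> < card (heavy n a m t)"
      then have ge: "card (heavy n a m t) \<le> card \<F> + card \<G>" by simp
      have "card (deletion n \<F>) + card (deletion n \<G>) \<le> card (heavy n' a m t)"
        unfolding n a
      proof (rule cross_intersecting_card_le_heavy[where b = "Suc b"])
        show "deletion (Suc n') \<F> \<subseteq> heavy n' (Suc a') m t"
          using deletion_mono[OF p(6), of "Suc n'"] by (simp add: deletion_heavy)
        show "Suc b + t \<le> Suc a' \<or> (\<forall>B\<in>deletion (Suc n') \<G>. B \<inter> {1..m} \<noteq> {})"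
          using p(12) by (auto simp: deletion_def)
        show "Suc b + t \<le> Suc (Suc a')" using p(12) by auto
      qed (use p(1-5) deletion_subset_nsets[OF p(7)] shift_closed_deletion[OF p(8)]
          shift_closed_deletion[OF p(9)] cross_intersecting_deletion[OF p(10)] in simp_all)
      then have ge': "card (heavy n' a' m t) \<le> card (link n \<F>) + card (link n \<G>)"
        using ge card_deletion_link[OF fin(1), of n] card_deletion_link[OF fin(2), of n]
          card_heavy_Suc[OF mn, of a' t] n a by simp
      have lF: "link n \<F> \<subseteq> heavy n' a' m t"
        using link_mono[OF p(6), of n] mn by (simp add: link_heavy n)
      have lG: "link n \<G> \<subseteq> nsets {1..n'} b"
        using link_subset_nsets[OF p(7)] n by simp
      have meets: "B \<inter> {1..m} \<noteq> {}" if "\<not> Suc b + t \<le> a" "B \<in> link n \<G>" for B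
        using that p(12) mn a n by (fastforce simp: link_def)
      \<comment> \<open>This preserves the condition \<open>2 <= t\<close> or nonempty first family
        for the induction hypothesis. On the borderline with \<open>t = 1\<close> all sets have the
        same size and heavy means meeting \<open>[m]\<close>. An empty link of \<open>\<F>\<close>
        would let the link of \<open>\<G>\<close> fill the heavy family, and then
        \<open>\<G>\<close> would contain a set disjoint from a member of
        \<open>\<F>\<close>.\<close>
      have lempty: False if "link n \<F> = {}" "t = 1" "\<not> Suc b + t \<le> a"
      proof -
        have ab: "a = Suc b" "\<F> \<noteq> {}" using that p(12) a by auto
        have "link n \<G> \<subseteq> heavy n' a' m t"
        proof
          fix B assume B: "B \<in> link n \<G>"
          then have "finite (B \<inter> {1..m})" "B \<inter> {1..m} \<noteq> {}" using meets that by auto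
          then have "1 \<le> card (B \<inter> {1..m})" by (simp add: Suc_le_eq card_gt_0_iff)
          then show "B \<in> heavy n' a' m t" using B lG ab a \<open>t = 1\<close> by (auto simp: heavy_def)
        qed
        then have "link n \<G> = heavy n' a' m t"
          using ge' that by (intro card_seteq) auto
        then have H: "heavy n a m t \<subseteq> \<G>"
          using heavy_subset_of_link[of n' \<G> a' m t] p(9) mn ta n a by simp
        obtain A where A: "A \<in> \<F>" using ab by blast
        then have An: "A \<subseteq> {1..n}" "finite A" "card A = a" using Fn n a by (auto simp: nsets_def)
        have "\<exists>B\<in>heavy n a m t. B \<inter> A = {}"
          using An Suc.prems(3,4,5) ab(1) ta a
          by (intro heavy_disjoint_exists card_interval_Diff_ge) simp_all
        then obtain B where "B \<in> heavy n a m t" "B \<inter> A = {}" by blast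
        then show False using H A Suc.prems(10) unfolding cross_intersecting_def by blast
      qed
      show False
      proof (cases "link n \<G> = {}")
        case True
        then have "link n \<F> = heavy n' a' m t"
          using ge' lF by (intro card_seteq) auto
        then have H: "heavy n a m t \<subseteq> \<F>"
          using heavy_subset_of_link[of n' \<F> a' m t] p(8) mn ta n a by simp
        obtain B where B: "B \<in> \<G>" using p(11) by blast
        then have Bn: "B \<subseteq> {1..n}" "finite B" "card B = Suc b" using p(7) n by (auto simp: nsets_def)
        have "\<exists>A\<in>heavy n a m t. A \<inter> B = {}"
          using Bn Suc.prems(3,4,5) ta a
          by (intro heavy_disjoint_exists card_interval_Diff_ge) simp_all
        then obtain A where "A \<in> heavy n a m t" "A \<inter> B = {}" by blast
        then show False using H B Suc.prems(10) unfolding cross_intersecting_def by blast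
      next
        case False
        have "card (link n \<F>) + card (link n \<G>) < card (heavy n' a' m t)"
        proof (rule Suc.IH)
          show "cross_intersecting (link n \<F>) (link n \<G>)"
            unfolding n using p(5) by (intro cross_intersecting_link[OF p(10,8) Fn p(7)]) simp
          show "b + t \<le> a' \<or> Suc a' = b + t \<and> t + 2 \<le> m \<and> (2 \<le> t \<or> link n \<F> \<noteq> {}) \<and>
            (\<forall>B\<in>link n \<G>. B \<inter> {1..m} \<noteq> {})"
          proof (cases "Suc b + t \<le> a")
            case True
            then show ?thesis using a by simp
          next
            case False
            then have "2 \<le> t \<or> link n \<F> \<noteq> {}" using lempty p(1) by force
            then show ?thesis using False meets p(12) a by auto
          qed
        qed (use p(1-5) lF lG False n shift_closed_link[OF p(8)] shift_closed_link[OF p(9)] in simp_all)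
        then show False using ge' by simp
      qed
    qed
  qed
qed

section \<open>The upper bound for normalised pairs\<close>

text \<open>The last two assumptions stand in for the covering numbers because they pass to
  deletions as long as \<open>a <= n\<close>. Fixing \<open>m\<close> by
  \<open>Suc m = b + t\<close> avoids truncated subtraction.\<close>

locale cross_pair =
  fixes n a b m t :: nat and \<F> \<G> :: "nat set set"
  assumes t_pos: "1 \<le> t" and b_pos: "1 \<le> b" and m_eq: "Suc m = b + t" and m_le: "m \<le> a"
    and F_sub: "\<F> \<subseteq> nsets {1..n} a" and G_sub: "\<G> \<subseteq> nsets {1..n} b"
    and F_closed: "shift_closed n \<F>" and G_closed: "shift_closed n \<G>"
    and cross: "cross_intersecting \<F> \<G>"
    and a_in_F: "{1..a} \<in> \<F>" and m_in_G: "nsets {1..m} b \<subseteq> \<G>"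
begin

text \<open>Otherwise at least \<open>m - t + 1 = b\<close> points of \<open>[m]\<close> would lie
  outside \<open>A\<close>, and \<open>b\<close> of them form a member of \<open>\<G>\<close>
  disjoint from \<open>A\<close>.\<close>

lemma F_heavy: "\<F> \<subseteq> heavy n a m t"
proof
  fix A assume A: "A \<in> \<F>"
  then have An: "A \<in> nsets {1..n} a" using F_sub by blast
  then have "finite A" by (auto simp: nsets_def)
  have "t \<le> card (A \<inter> {1..m})"
  proof (rule ccontr)
    assume "\<not> t \<le> card (A \<inter> {1..m})"
    moreover have "card ({1..m} - A) = m - card (A \<inter> {1..m})"
      using card_Diff_subset_Int[of "{1..m}" A] \<open>finite A\<close> by (simp add: Int_commute)
    ultimately have "b \<le> card ({1..m} - A)" using m_eq by simp
    then obtain B where "B \<subseteq> {1..m} - A" "card B = b" "finite B"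
      by (meson obtain_subset_with_card_n)
    then have "B \<in> \<G>" "A \<inter> B = {}" using m_in_G by (auto simp: nsets_def)
    then show False using cross A by (auto simp: cross_intersecting_def)
  qed
  then show "A \<in> heavy n a m t" using An by (simp add: heavy_def)
qed

text \<open>At most \<open>b - 1\<close> points of \<open>B\<close> lie in \<open>[m]\<close>, and
  \<open>m - (b - 1) = t\<close>. This leaves room for the \<open>t\<close> points of a heavy set
  avoiding \<open>B\<close>; a \<open>b\<close>-subset of \<open>[m]\<close> leaves only
  \<open>t - 1\<close>.\<close>

lemma card_Diff_not_subset:
  assumes "B \<in> \<G>" "\<not> B \<subseteq> {1..m}"
  shows "t \<le> card ({1..m} - B)"
proof -
  have B: "finite B" "card B = b" using assms G_sub by (auto simp: nsets_def)
  then have "card (B \<inter> {1..m}) < b" using assms(2) psubset_card_mono[of B "B \<inter> {1..m}"] by blast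
  moreover have "card ({1..m} - B) = m - card (B \<inter> {1..m})"
    using card_Diff_subset_Int[of "{1..m}" B] B by (simp add: Int_commute)
  ultimately show ?thesis using m_eq by simp
qed

end

lemma cross_pair_deletion:
  assumes "cross_pair (Suc n) a b m t \<F> \<G>" "a \<le> n"
  shows "cross_pair n a b m t (deletion (Suc n) \<F>) (deletion (Suc n) \<G>)"
proof -
  interpret cross_pair "Suc n" a b m t \<F> \<G> by fact
  show ?thesis
  proof
    show "nsets {1..m} b \<subseteq> deletion (Suc n) \<G>"
      using m_in_G m_le assms(2) by (fastforce simp: deletion_def nsets_def)
    show "{1..a} \<in> deletion (Suc n) \<F>" using a_in_F assms(2) by (simp add: deletion_def)
  qed (use t_pos b_pos m_eq m_le deletion_subset_nsets[OF F_sub] deletion_subset_nsets[OF G_sub]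
      shift_closed_deletion[OF F_closed] shift_closed_deletion[OF G_closed]
      cross_intersecting_deletion[OF cross] in simp_all)
qed

lemma cross_pair_link_meets:
  assumes "cross_pair (Suc n) a b m t \<F> \<G>" "a \<le> n" "B \<in> link (Suc n) \<G>"
  shows "B \<inter> {1..a} \<noteq> {}"
proof -
  interpret cross_pair "Suc n" a b m t \<F> \<G> by fact
  have "{1..a} \<inter> insert (Suc n) B \<noteq> {}"
    using cross a_in_F assms(3) unfolding cross_intersecting_def link_def by blast
  then show ?thesis using assms(2) by auto
qed

text \<open>For the links \<open>b + t = m\<close>, so the bound by heavy sets applies, which
  \<open>Suc b + t > m\<close> forbids for \<open>\<F>\<close> and \<open>\<G>\<close> themselves.
  If \<open>m <= a\<close>, its first alternative holds; otherwise \<open>m = Suc a\<close>, and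
  members of the link of \<open>\<G>\<close> meet \<open>[m]\<close> because \<open>[m]\<close> is
  in \<open>\<F>\<close>.\<close>

lemma cross_pair_link_le:
  assumes "cross_pair (Suc n) (Suc a) (Suc b) m t \<F> \<G>" "a + b + 2 \<le> n"
  shows "card (link (Suc n) \<F>) + card (link (Suc n) \<G>) \<le> card (heavy n a m t)"
proof -
  interpret cross_pair "Suc n" "Suc a" "Suc b" m t \<F> \<G> by fact
  show ?thesis
  proof (rule cross_intersecting_card_le_heavy[where b = b])
    show "link (Suc n) \<F> \<subseteq> heavy n a m t"
      using link_mono[OF F_heavy, of "Suc n"] m_le assms(2) by (simp add: link_heavy)
    show "b + t \<le> a \<or> (\<forall>B\<in>link (Suc n) \<G>. B \<inter> {1..m} \<noteq> {})"
    proof (cases "m \<le> a")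
      case True
      then show ?thesis using m_eq by simp
    next
      case False
      then have "m = Suc a" using m_le by simp
      then show ?thesis using cross_pair_link_meets[OF assms(1)] assms(2) by auto
    qed
    show "cross_intersecting (link (Suc n) \<F>) (link (Suc n) \<G>)"
      using assms(2) by (intro cross_intersecting_link[OF cross F_closed F_sub G_sub]) auto
  qed (use t_pos m_eq m_le assms(2) link_subset_nsets[OF G_sub]
      shift_closed_link[OF F_closed] shift_closed_link[OF G_closed] in simp_all)
qed

lemma cross_pair_card_le:
  assumes "cross_pair n a b m t \<F> \<G>" "a + b \<le> n"
  shows "card \<F> + card \<G> \<le> card (heavy n a m t) + card (nsets {1..m} b)"
  using assms(2,1)
proof (induction n arbitrary: \<F> \<G> rule: dec_induct)
  case base
  interpret cross_pair "a + b" a b m t \<F> \<G> by fact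
  \<comment> \<open>These complements have only \<open>t - 1\<close> points in \<open>[m]\<close>,
    so they are not heavy and account for the extra summand. All other members of
    \<open>\<G>\<close> have heavy complements.\<close>
  let ?C = "(-) {1..a + b} ` nsets {1..m} b"
  have "card \<F> + card \<G> \<le> card (heavy (a + b) a m t \<union> ?C)"
  proof (rule card_add_le_of_complement[OF cross])
    fix B assume B: "B \<in> \<G>"
    show "{1..a + b} - B \<in> heavy (a + b) a m t \<union> ?C"
    proof (cases "B \<subseteq> {1..m}")
      case True
      then have "B \<in> nsets {1..m} b" using B G_sub by (auto simp: nsets_def)
      then show ?thesis by blast
    next
      case False
      have "({1..a + b} - B) \<inter> {1..m} = {1..m} - B" using m_le by auto
      then show ?thesis
        using card_Diff_not_subset[OF B False] compl_mem_nsets[of B a b] B G_sub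
        by (auto simp: heavy_def)
    qed
  qed (use F_heavy G_sub in \<open>auto simp: nsets_def finite_imp_finite_nsets\<close>)
  also have "\<dots> \<le> card (heavy (a + b) a m t) + card ?C" by (rule card_Un_le)
  also have "card ?C \<le> card (nsets {1..m} b)"
    by (intro card_image_le finite_imp_finite_nsets) auto
  finally show ?case by simp
next
  case (step n)
  interpret cross_pair "Suc n" a b m t \<F> \<G> by fact
  obtain b' where b: "b = Suc b'" using b_pos by (cases b) auto
  obtain a' where a: "a = Suc a'" using m_eq m_le b t_pos by (cases a) auto
  have "card (deletion (Suc n) \<F>) + card (deletion (Suc n) \<G>)
      \<le> card (heavy n a m t) + card (nsets {1..m} b)"
    using step by (intro step.IH cross_pair_deletion) auto
  moreover have "card (link (Suc n) \<F>) + card (link (Suc n) \<G>) \<le> card (heavy n a' m t)"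
    using step a b by (intro cross_pair_link_le) auto
  ultimately show ?case
    using card_deletion_link[OF finite_subset_nsets[OF F_sub], of "Suc n"]
      card_deletion_link[OF finite_subset_nsets[OF G_sub], of "Suc n"]
      card_heavy_Suc[of m n a' t] m_le step(1) a by simp
qed

section \<open>Equality in the bound\<close>

text \<open>Only the union is determined, since for \<open>a = b\<close> the families may trade
  places. The excluded case is a real exception for \<open>t >= 2\<close>: if \<open>b = 2\<close>
  and \<open>a = m\<close>, then \<open>\<F> = {{1..a}}\<close> with all 2-sets meeting
  \<open>[a]\<close> as \<open>\<G>\<close> also attains the bound.\<close>

lemma cross_pair_card_eq_imp_union:
  assumes "cross_pair n a b m t \<F> \<G>" "a + b < n" "\<not> (b = 2 \<and> a = m)"
    and eq: "card \<F> + card \<G> = card (heavy n a m t) + card (nsets {1..m} b)"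
  shows "\<F> \<union> \<G> = heavy n a m t \<union> nsets {1..m} b"
proof -
  interpret cross_pair n a b m t \<F> \<G> by fact
  obtain b' where b: "b = Suc b'" using b_pos by (cases b) auto
  obtain a' where a: "a = Suc a'" using m_eq m_le b t_pos by (cases a) auto
  obtain n' where n: "n = Suc n'" using assms(2) by (cases n) auto
  note cp = assms(1)[unfolded n]
  have mn: "m \<le> n'" using m_le assms(2) n by simp
  have "card (deletion n \<F>) + card (deletion n \<G>) \<le> card (heavy n' a m t) + card (nsets {1..m} b)"
    using cross_pair_card_le[OF cross_pair_deletion[OF cp]] assms(2) n by simp
  then have ge: "card (heavy n' a' m t) \<le> card (link n \<F>) + card (link n \<G>)"
    using eq card_deletion_link[OF finite_subset_nsets[OF F_sub], of n]
      card_deletion_link[OF finite_subset_nsets[OF G_sub], of n]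
      card_heavy_Suc[OF mn, of a' t] a n by simp
  have lF: "link n \<F> \<subseteq> heavy n' a' m t"
    using link_mono[OF F_heavy, of n] link_heavy[OF mn, of a' t] by (simp add: n a)
  have lG: "link n \<G> \<subseteq> nsets {1..n'} b'"
    using link_subset_nsets[of \<G> n' b'] G_sub n b by simp
  have meets: "B \<inter> {1..a} \<noteq> {}" if "B \<in> link n \<G>" for B
    using cross_pair_link_meets[OF cp] that assms(2) n by auto
  show ?thesis
  proof (cases "link n \<G> = {}")
    case True
    then have link_eq: "link n \<F> = heavy n' a' m t"
      using ge lF by (intro card_seteq) auto
    have "heavy n a m t \<subseteq> \<F>"
    proof (cases "t \<le> a'")
      case True
      then show ?thesis
        using heavy_subset_of_link[of n' \<F> a' m t] F_closed link_eq mn n a by simp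
    next
      case False
      then have am: "a = m" "t = a" using m_eq m_le a b by auto
      have "A = {1..a}" if "A \<in> heavy n a m t" for A
      proof -
        have A: "finite A" "card A = a" "a \<le> card (A \<inter> {1..a})"
          using that am by (auto simp: heavy_def nsets_def)
        then have "A \<inter> {1..a} = A" by (intro card_seteq) auto
        moreover have "A \<inter> {1..a} = {1..a}" using A by (intro card_seteq) auto
        ultimately show ?thesis by simp
      qed
      then show ?thesis using a_in_F by blast
    qed
    then have F: "\<F> = heavy n a m t" using F_heavy by blast
    have "B \<subseteq> {1..m}" if "B \<in> \<G>" for B
    proof (rule ccontr)
      assume "\<not> B \<subseteq> {1..m}"
      then have "t \<le> card ({1..m} - B)" using card_Diff_not_subset that by blast
      moreover have "B \<subseteq> {1..n}" "card B = b" using that G_sub by (auto simp: nsets_def)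
      ultimately have "\<exists>A\<in>heavy n a m t. A \<inter> B = {}"
        using assms(2) m_le m_eq b by (intro heavy_disjoint_exists) simp_all
      then obtain A where "A \<in> heavy n a m t" "A \<inter> B = {}" by blast
      then show False using F cross that by (auto simp: cross_intersecting_def)
    qed
    then have "\<G> = nsets {1..m} b" using m_in_G G_sub by (auto simp: nsets_def)
    then show ?thesis using F by simp
  next
    case False
    have "b' \<noteq> 0"
    proof
      assume "b' = 0"
      then have "{} \<in> link n \<G>" using lG False nsets_zero_cases by blast
      then show False using meets by blast
    qed
    have "\<not> card (link n \<F>) + card (link n \<G>) < card (heavy n' a' m t)" using ge by simp
    \<comment> \<open>As the bound is attained, the strict inequality must fail for the links. For
      \<open>a > m\<close> its first alternative would hold; for \<open>a = m\<close> the exclusion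
      of \<open>b = 2\<close> gives \<open>t + 2 <= m\<close>. What survives is
      \<open>a = m\<close>, \<open>t = 1\<close> and an empty link of \<open>\<F>\<close>.\<close>
    then have "\<not> (b' + t \<le> a' \<or>
       Suc a' = b' + t \<and> t + 2 \<le> m \<and> (2 \<le> t \<or> link n \<F> \<noteq> {}) \<and>
       (\<forall>B\<in>link n \<G>. B \<inter> {1..m} \<noteq> {}))"
    proof (rule contrapos_nn)
      assume "b' + t \<le> a' \<or>
       Suc a' = b' + t \<and> t + 2 \<le> m \<and> (2 \<le> t \<or> link n \<F> \<noteq> {}) \<and>
       (\<forall>B\<in>link n \<G>. B \<inter> {1..m} \<noteq> {})"
      then show "card (link n \<F>) + card (link n \<G>) < card (heavy n' a' m t)"
      proof (rule cross_intersecting_card_less_heavy[rotated -1, where b = b'])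
        show "cross_intersecting (link n \<F>) (link n \<G>)"
          unfolding n using cross F_closed F_sub G_sub assms(2) n a b
          by (intro cross_intersecting_link[of _ _ _ a' b']) auto
      qed (use t_pos m_eq m_le lF lG F_closed G_closed assms(2) n a b False \<open>b' \<noteq> 0\<close> in
          \<open>auto intro: shift_closed_link\<close>)
    qed
    note not_strict = this
    then have am: "a = m" using m_eq m_le a b by simp
    moreover have "Suc a' = b' + t" "t + 2 \<le> m"
      using am m_eq a b assms(3) \<open>b' \<noteq> 0\<close> by auto
    ultimately have "\<not> (2 \<le> t \<or> link n \<F> \<noteq> {})" using not_strict meets by blast
    then have am: "a = m" "t = 1" "link n \<F> = {}" using am t_pos by auto
    then have ab: "a = b" using m_eq by simp
    \<comment> \<open>Heavy now just means meeting \<open>[a]\<close>, and \<open>a = b\<close>. So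
      the link of \<open>\<G>\<close> is heavy, and the first case repeats with the families
      swapped, ending in \<open>\<F> = {{1..m}}\<close>.\<close>
    have heavyI: "B \<in> heavy k c m t" if "B \<in> nsets {1..k} c" "B \<inter> {1..a} \<noteq> {}" for B k c
    proof -
      have "1 \<le> card (B \<inter> {1..m})" using that am by (simp add: Suc_le_eq card_gt_0_iff)
      then show ?thesis using that am by (simp add: heavy_def)
    qed
    have "link n \<G> = heavy n' a' m t"
    proof (rule card_seteq)
      show "link n \<G> \<subseteq> heavy n' a' m t" using lG meets heavyI ab a b by auto
    qed (use ge am in auto)
    then have "heavy n a m t \<subseteq> \<G>"
      using heavy_subset_of_link[of n' \<G> a' m t] G_closed mn n ab am(2) \<open>b' \<noteq> 0\<close>
      unfolding a b by simp
    moreover have "\<G> \<subseteq> heavy n a m t"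
    proof
      fix B assume "B \<in> \<G>"
      then have "{1..a} \<inter> B \<noteq> {}" "B \<in> nsets {1..n} a"
        using cross a_in_F G_sub ab by (auto simp: cross_intersecting_def)
      then show "B \<in> heavy n a m t" by (intro heavyI) auto
    qed
    ultimately have G: "\<G> = heavy n a m t" by blast
    have "A = {1..m}" if "A \<in> \<F>" for A
    proof (rule ccontr)
      assume neq: "A \<noteq> {1..m}"
      have A: "A \<subseteq> {1..n}" "finite A" "card A = m" using that F_sub am by (auto simp: nsets_def)
      then have "\<not> {1..m} \<subseteq> A" using neq card_seteq[of A "{1..m}"] by auto
      then have "1 \<le> card ({1..m} - A)" by (simp add: Suc_le_eq card_gt_0_iff)
      then have "\<exists>B\<in>heavy n a m t. B \<inter> A = {}"
        using A am(1,2) ab assms(2) a by (intro heavy_disjoint_exists) simp_all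
      then obtain B where "B \<in> heavy n a m t" "B \<inter> A = {}" by blast
      then show False using G cross that by (auto simp: cross_intersecting_def)
    qed
    then have "\<F> = {{1..m}}" using a_in_F[unfolded am(1)] by blast
    moreover have "nsets {1..m} b = {{1..m}}"
      using card_subset_eq[of "{1..m}"] unfolding ab[symmetric] am(1)
      by (auto simp: nsets_def)
    ultimately show ?thesis using G by blast
  qed
qed

section \<open>Domination, covering numbers and initial segments\<close>

text \<open>The assumption on initial segments is the usual componentwise order of sorted sets.\<close>

lemma shift_closed_dominated:
  assumes "shift_closed n \<F>" "B \<in> \<F>" "B \<subseteq> {1..n}" "C \<subseteq> {1..n}" "card B = card C"
    "\<And>k. card (B \<inter> {..k}) \<le> card (C \<inter> {..k})"
  shows "C \<in> \<F>"
  using assms(2,3,5,6)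
proof (induction "card (B - C)" arbitrary: B rule: less_induct)
  case less
  have fin: "finite B" "finite C" using less.prems(2) assms(4) finite_subset by blast+
  show ?case
  proof (cases "B \<subseteq> C")
    case True
    then show ?thesis using card_subset_eq[of C B] fin less.prems by simp
  next
    case False
    \<comment> \<open>As \<open>j\<close> is in \<open>B\<close> but not in \<open>C\<close>,
      domination at \<open>j\<close> supplies an \<open>i < j\<close> in \<open>C\<close> but not in
      \<open>B\<close>. Moving \<open>j\<close> to \<open>i\<close> shrinks \<open>B - C\<close> and
      keeps domination: counts up to \<open>k >= j\<close> do not change, and for
      \<open>k < j\<close> minimality of \<open>j\<close> puts the new initial part inside
      \<open>C\<close>.\<close>
    define j where "j = Min (B - C)"
    have j: "j \<in> B" "j \<notin> C" using Min_in[of "B - C"] fin False unfolding j_def by auto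
    have j_min: "x \<in> C" if "x \<in> B" "x < j" for x
      using Min_le[of "B - C" x] that fin unfolding j_def by fastforce
    have "\<not> C \<inter> {..j} \<subseteq> B \<inter> {..j}"
    proof
      assume "C \<inter> {..j} \<subseteq> B \<inter> {..j}"
      then have "C \<inter> {..j} = B \<inter> {..j}" using less.prems(4)[of j] by (intro card_seteq) auto
      then show False using j by blast
    qed
    then obtain i where i: "i \<in> C" "i \<notin> B" "i \<le> j" by blast
    then have ij: "i < j" using j by (metis le_neq_implies_less)
    let ?B = "insert i (B - {j})"
    have card_B: "card ?B = card B"
      using i j fin card_Suc_Diff1[of B j] by simp
    show ?thesis
    proof (rule less.hyps)
      have "?B - C = (B - C) - {j}" using i j by auto
      then show "card (?B - C) < card (B - C)"
        using j fin by (simp only:) (intro psubset_card_mono; auto)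
      show "?B \<in> \<F>"
        using i j ij less.prems assms(4) by (intro shift_closedD[OF assms(1)]) auto
      show "?B \<subseteq> {1..n}" using i less.prems(2) assms(4) by blast
      show "card ?B = card C" using card_B less.prems(3) by simp
      show "card (?B \<inter> {..k}) \<le> card (C \<inter> {..k})" for k
      proof (cases "k < j")
        case True
        then have "?B \<inter> {..k} \<subseteq> C \<inter> {..k}" using i j_min by auto
        then show ?thesis using fin by (intro card_mono) auto
      next
        case False
        then have "?B \<inter> {..k} = insert i (B \<inter> {..k} - {j})" using ij by auto
        moreover have "card (insert i (B \<inter> {..k} - {j})) = card (B \<inter> {..k})"
          using i j fin False card_Suc_Diff1[of "B \<inter> {..k}" j] by simp
        ultimately show ?thesis using less.prems(4)[of k] by simp
      qed
    qed
  qed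
qed

lemma covering_number_le:
  assumes "T \<subseteq> {1..n}" "\<And>F. F \<in> \<F> \<Longrightarrow> T \<inter> F \<noteq> {}"
  shows "covering_number n \<F> \<le> card T"
  unfolding covering_number_def
proof (rule Min_le)
  show "finite (card ` {T. T \<subseteq> {1..n} \<and> (\<forall>F\<in>\<F>. T \<inter> F \<noteq> {})})"
    by (intro finite_imageI, rule finite_subset[of _ "Pow {1..n}"]) auto
qed (use assms in \<open>auto intro!: imageI\<close>)

lemma card_isomorphic_families:
  assumes "isomorphic_families n \<A> \<B>"
  shows "card \<A> = card \<B>"
proof -
  obtain p where p: "p permutes {1..n}" "(`) p ` \<A> = \<B>"
    using assms by (auto simp: isomorphic_families_def)
  then have "inj p" using permutes_inj by blast
  then have "inj_on ((`) p) \<A>" by (meson inj_image_eq_iff inj_onI)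
  then show ?thesis using p(2) card_image by metis
qed

text \<open>\<open>[a]\<close> dominates every \<open>a\<close>-set, having the largest possible
  number \<open>min a k\<close> of points up to \<open>k\<close>.\<close>

lemma initial_segment_mem:
  assumes "shift_closed n \<F>" "\<F> \<subseteq> nsets {1..n} a" "\<F> \<noteq> {}" "a \<le> n"
  shows "{1..a} \<in> \<F>"
proof -
  obtain B where B: "B \<in> \<F>" using assms(3) by blast
  then have Bn: "B \<subseteq> {1..n}" "finite B" "card B = a" using assms(2) by (auto simp: nsets_def)
  show ?thesis
  proof (rule shift_closed_dominated[OF assms(1) B Bn(1)])
    fix k
    have "card (B \<inter> {..k}) \<le> card B" using Bn by (intro card_mono) auto
    moreover have "card (B \<inter> {..k}) \<le> card {1..k}"
      using Bn(1) by (intro card_mono) auto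
    moreover have "{1..a} \<inter> {..k} = {1..min a k}" by auto
    ultimately show "card (B \<inter> {..k}) \<le> card ({1..a} \<inter> {..k})" using Bn by simp
  qed (use Bn assms(4) in auto)
qed

text \<open>The set \<open>[t - 1]\<close> is too small to be a cover, so some \<open>B\<close> in
  \<open>\<G>\<close> avoids it and has at most \<open>k + 1 - t\<close> points up to
  \<open>k\<close>. For \<open>k < m\<close>, a \<open>b\<close>-subset of \<open>[m]\<close> has at
  most \<open>m - k\<close> points beyond \<open>k\<close>, hence at least
  \<open>b - (m - k) = k + 1 - t\<close> up to \<open>k\<close>, and so dominates
  \<open>B\<close>.\<close>

lemma nsets_initial_segment_subset:
  assumes "shift_closed n \<G>" "\<G> \<subseteq> nsets {1..n} b" "t \<le> covering_number n \<G>" "1 \<le> t"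
    "Suc m = b + t" "m \<le> n"
  shows "nsets {1..m} b \<subseteq> \<G>"
proof (cases "b = 0")
  case True
  have "\<G> \<noteq> {}" using covering_number_le[of "{}" n \<G>] assms(3,4) by auto
  then show ?thesis using nsets_zero_cases assms(2) True by (auto simp: nsets_def)
next
  case False
  have "\<exists>B\<in>\<G>. {1..t - 1} \<inter> B = {}"
  proof (rule ccontr)
    assume "\<not> (\<exists>B\<in>\<G>. {1..t - 1} \<inter> B = {})"
    then have "covering_number n \<G> \<le> card {1..t - 1}"
      using assms(5,6) False by (intro covering_number_le) auto
    then show False using assms(3,4) by simp
  qed
  then obtain B where B: "B \<in> \<G>" "{1..t - 1} \<inter> B = {}" by blast
  then have Bn: "B \<subseteq> {1..n}" "finite B" "card B = b" using assms(2) by (auto simp: nsets_def)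
  show ?thesis
  proof
    fix C assume "C \<in> nsets {1..m} b"
    then have C: "C \<subseteq> {1..m}" "finite C" "card C = b" by (auto simp: nsets_def)
    show "C \<in> \<G>"
    proof (rule shift_closed_dominated[OF assms(1) B(1) Bn(1)])
      fix k
      show "card (B \<inter> {..k}) \<le> card (C \<inter> {..k})"
      proof (cases "m \<le> k")
        case True
        then have "C \<inter> {..k} = C" using C by auto
        moreover have "card (B \<inter> {..k}) \<le> card B" using Bn by (intro card_mono) auto
        ultimately show ?thesis using Bn C by simp
      next
        case False
        have "B \<inter> {..k} \<subseteq> {t..k}"
        proof
          fix x assume x: "x \<in> B \<inter> {..k}"
          then have "1 \<le> x" "x \<notin> {1..t - 1}" using Bn B(2) by auto
          then show "x \<in> {t..k}" using x by auto
        qed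
        then have le: "card (B \<inter> {..k}) \<le> Suc k - t"
          using card_mono[of "{t..k}" "B \<inter> {..k}"] by simp
        have "C \<subseteq> (C \<inter> {..k}) \<union> {k<..m}" using C by auto
        then have "card C \<le> card ((C \<inter> {..k}) \<union> {k<..m})" using C by (intro card_mono) auto
        also have "\<dots> \<le> card (C \<inter> {..k}) + (m - k)" using card_Un_le[of "C \<inter> {..k}" "{k<..m}"] by simp
        finally show ?thesis using le C False assms(5) by simp
      qed
    qed (use C Bn assms(6) in auto)
  qed
qed

theorem theorem9:
  fixes n a b t :: nat and \<F> \<G> :: "nat set set"
  assumes "n \<ge> 1" "a \<ge> 1" "b \<ge> 1" "t \<ge> 1"
    and "a \<ge> b + t - 1" and "n \<ge> a + b"
    and "\<F> \<subseteq> nsets {1..n} a" and "\<G> \<subseteq> nsets {1..n} b"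
    and "initial_family n \<F>" and "initial_family n \<G>"
    and "cross_intersecting \<F> \<G>"
    and "covering_number n \<F> \<ge> 1" and "covering_number n \<G> \<ge> t"
  shows "card \<F> + card \<G> \<le> card (H_family t n a b) + of_bool (a = b)
    \<and> (n > a + b \<longrightarrow> \<not> (b = 2 \<and> a = b + t - 1) \<longrightarrow>
        (card \<F> + card \<G> = card (H_family t n a b) + of_bool (a = b)
          \<longleftrightarrow> isomorphic_families n (\<F> \<union> \<G>) (H_family t n a b)))
    \<and> (n > a + b \<longrightarrow>
        isomorphic_families n (\<F> \<union> \<G>) (H_family t n a b) \<longrightarrow>
          card \<F> + card \<G> = card (H_family t n a b) + of_bool (a = b))"
proof -
  define m where "m = b + t - 1"
  note closed = assms(9,10)[THEN initial_family_imp_shift_closed]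
  \<comment> \<open>The empty set covers the empty family, so a positive covering number excludes
    it.\<close>
  have "\<F> \<noteq> {}" using covering_number_le[of "{}" n \<F>] assms(12) by auto
  then have a_in: "{1..a} \<in> \<F>"
    using initial_segment_mem[OF closed(1) assms(7)] assms(6) by simp
  have m_in: "nsets {1..m} b \<subseteq> \<G>"
    using assms m_def by (intro nsets_initial_segment_subset[OF closed(2) assms(8,13)]) auto
  have cp: "cross_pair n a b m t \<F> \<G>"
    by unfold_locales (use assms closed a_in m_in m_def in auto)
  have H: "H_family t n a b = heavy n a m t \<union> nsets {1..m} b"
    by (simp add: H_family_def heavy_def m_def)
  have parts: "card (heavy n a m t) + card (nsets {1..m} b)
      = card (H_family t n a b) + of_bool (a = b)"
    using card_H_family_parts[OF assms(1-6)] by (simp only: heavy_def m_def)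
  have le: "card \<F> + card \<G> \<le> card (H_family t n a b) + of_bool (a = b)"
    using cross_pair_card_le[OF cp assms(6)] parts by simp
  have iso: "isomorphic_families n (\<F> \<union> \<G>) (H_family t n a b)"
    if "n > a + b" "\<not> (b = 2 \<and> a = b + t - 1)"
      "card \<F> + card \<G> = card (H_family t n a b) + of_bool (a = b)"
  proof -
    have "\<F> \<union> \<G> = H_family t n a b"
      using cross_pair_card_eq_imp_union[OF cp] that parts H m_def by simp
    then show ?thesis
      unfolding isomorphic_families_def by (intro exI[of _ id]) (simp add: permutes_id)
  qed
  have eq: "card \<F> + card \<G> = card (H_family t n a b) + of_bool (a = b)"
    if "isomorphic_families n (\<F> \<union> \<G>) (H_family t n a b)"
  proof -
    have fin: "finite \<F>" "finite \<G>" using assms(7,8) finite_subset_nsets by blast+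
    \<comment> \<open>The union has the size of \<open>H_family\<close>, so the intersection must be
      compared with \<open>of_bool (a = b)\<close>. It is at least that large, since
      \<open>[a]\<close> lies in both families when \<open>a = b\<close>; \<open>le\<close> gives
      the reverse inequality.\<close>
    have "card \<F> + card \<G> = card (H_family t n a b) + card (\<F> \<inter> \<G>)"
      using card_Un_Int[OF fin] card_isomorphic_families[OF that] by simp
    moreover have "of_bool (a = b) \<le> card (\<F> \<inter> \<G>)"
    proof (cases "a = b")
      case True
      then have "\<G> \<noteq> {}" using covering_number_le[of "{}" n \<G>] assms(4,13) by auto
      then have "{1..b} \<in> \<G>"
        using initial_segment_mem[OF closed(2) assms(8)] assms(6) by simp
      then have "{1..a} \<in> \<F> \<inter> \<G>" using a_in True by simp
      then have "0 < card (\<F> \<inter> \<G>)" using fin card_gt_0_iff by blast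
      then show ?thesis by simp
    qed simp
    ultimately show ?thesis using le by linarith
  qed
  show ?thesis using le iso eq by blast
qed

end
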